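(* Let $n\ge2$, $\lambda>0$, and let $k_1,\dots,k_n\in\mathbb{R}$ be pairwise distinct. Let $Z\sim MHE(k_1,\dots,k_n,\lambda)$, let $Y_i\sim\mathrm{ExtremeValue}(k_i,\lambda)$, and put $PE_i=\prod_{j=1,\,j\ne i}^n\left(1-e^{\frac{k_i-k_j}{\lambda}}\right)$. Then, for all $t\in\mathbb{R}$, the cumulative distribution function of $Z$ is $$F_Z(t)=\sum_{i=1}^n\frac{1}{PE_i}F_{Y_i}(t)=\sum_{i=1}^n\frac{1}{\prod_{j=1,\,j\neq i}^n\left(1-e^{\frac{k_i-k_j}{\lambda}}\right)}\,e^{-e^{-\frac{t-k_i}{\lambda}}}.$$
   Context: $\mathrm{ExtremeValue}(k,\lambda)$ with location $k\in\mathbb{R}$ and scale $\lambda>0$ has density $\frac1\lambda\exp\left(-e^{\frac{-t+k}{\lambda}}+\frac{-t+k}{\lambda}\right)$, $t\in\mathbb{R}$. The Mixed Hypoexponential Extreme Value distribution $MHE(k_1,\dots,k_n,\lambda)$ is the distribution with density $f_Z(t)=\sum_{i=1}^n\frac{1}{PE_i}f_{Y_i}(t)$. $F_X$ denotes the cumulative distribution function of $X$. *)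

theory Defs
  imports "HOL-Probability.Probability"
begin

definition extreme_value_density :: "real \<Rightarrow> real \<Rightarrow> real \<Rightarrow> real" where
  "extreme_value_density k l t = 1 / l * exp (- exp ((- t + k) / l) + (- t + k) / l)"

definition PE :: "nat \<Rightarrow> (nat \<Rightarrow> real) \<Rightarrow> real \<Rightarrow> nat \<Rightarrow> real" where
  "PE n k l i = (\<Prod>j\<in>{1..n} - {i}. 1 - exp ((k i - k j) / l))"

(* The weights 1 / PE n k l i have mixed signs, but for pairwise distinct k 1, ..., k n and
   l > 0 the sum is a nonnegative function with integral 1, so composing it with ennreal,
   as "distributed" requires, truncates nothing. *)
definition MHE_density :: "nat \<Rightarrow> (nat \<Rightarrow> real) \<Rightarrow> real \<Rightarrow> real \<Rightarrow> real" where
  "MHE_density n k l t = (\<Sum>i=1..n. 1 / PE n k l i * extreme_value_density (k i) l t)"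

end

theory Submission
  imports Defs "HOL-Real_Asymp.Real_Asymp"
begin

text \<open>
  The weights 1 / PE n k l i are the values at 0 of the Lagrange basis polynomials for the nodes
  exp (k i / l), so they sum to 1, and hence the MHE density f has integral 1. Since f is the density
  of the random variable Z, its positive part has integral 1 as well; hence the negative part
  vanishes almost everywhere, and F_Z is obtained by integrating f term by term.
\<close>

section \<open>Lagrange basis polynomials and the sum of the weights\<close>

text \<open>Both sides are polynomials in \<open>z\<close> of degree below \<open>card I\<close>,
  and they agree at the \<open>card I\<close> distinct nodes \<open>x i\<close>, so they are equal
  everywhere.\<close>

lemma sum_lagrange_basis_eq_1:
  fixes x :: "'i \<Rightarrow> 'a::field"
  assumes "finite I" and "I \<noteq> {}" and inj: "inj_on x I"
  shows "(\<Sum>i\<in>I. \<Prod>j\<in>I - {i}. (z - x j) / (x i - x j)) = 1"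
proof -
  \<comment> \<open>The basis is built from formal polynomials, so that agreement at the nodes can
    be combined with a degree bound.\<close>
  define L where "L i = (\<Prod>j\<in>I - {i}. smult (1 / (x i - x j)) [:- x j, 1:])" for i
  have poly_L: "poly (L i) w = (\<Prod>j\<in>I - {i}. (w - x j) / (x i - x j))" for i w
    by (simp add: L_def poly_prod diff_divide_distrib)
  have degree_L: "degree (L i) < card I" if "i \<in> I" for i
  proof -
    \<comment> \<open>Each of the \<open>card I - 1\<close> factors has degree at most 1.\<close>
    have "degree (L i) \<le> (\<Sum>j\<in>I - {i}. 1)"
      unfolding L_def
      by (rule order.trans[OF degree_prod_sum_le])
        (use \<open>finite I\<close> in \<open>auto intro!: sum_mono simp del: sum_constant split: if_splits\<close>)
    also have "\<dots> < card I"
      using that \<open>finite I\<close> by (simp add: card_gt_0_iff \<open>I \<noteq> {}\<close>)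
    finally show ?thesis .
  qed
  have "(\<Sum>i\<in>I. L i) = 1"
  proof (rule poly_eqI_degree)
    fix w assume "w \<in> x ` I"
    then obtain m where m: "m \<in> I" "w = x m" by blast
    have "poly (L i) (x m) = (if i = m then 1 else 0)" if "i \<in> I" for i
    proof (cases "i = m")
      case True
      \<comment> \<open>Since \<open>0 / 0 = 0\<close> in HOL, the factors equal 1 only because the
        nodes are distinct.\<close>
      have "x m - x j \<noteq> 0" if "j \<in> I - {m}" for j
        using that m inj by (auto dest: inj_onD)
      then show ?thesis
        using True by (simp add: poly_L)
    next
      case False
      \<comment> \<open>The factor with index \<open>m\<close> vanishes at its own node.\<close>
      then have "\<exists>j\<in>I - {i}. (x m - x j) / (x i - x j) = 0"
        using m by (intro bexI[of _ m]) auto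
      then show ?thesis
        using False \<open>finite I\<close> by (simp add: poly_L)
    qed
    then show "poly (\<Sum>i\<in>I. L i) w = poly 1 w"
      using m \<open>finite I\<close> by (simp add: poly_sum)
  next
    have "card (x ` I) = card I"
      using inj by (rule card_image)
    moreover have "0 < card I"
      using assms by (simp add: card_gt_0_iff)
    ultimately show "degree (\<Sum>i\<in>I. L i) < card (x ` I)" "degree (1::'a poly) < card (x ` I)"
      using degree_L by (auto intro: degree_sum_less)
  qed
  from arg_cong[OF this, of "\<lambda>p. poly p z"] show ?thesis
    by (simp add: poly_sum poly_L)
qed

text \<open>With \<open>x i = exp (k i / l)\<close>, each factor of \<open>1 / PE n k l i\<close> is
  \<open>1 / (1 - x i / x j) = (0 - x j) / (x i - x j)\<close>, which is a factor of the Lagrange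
  basis polynomial at 0.\<close>

lemma sum_inverse_PE:
  assumes "n \<ge> 1" and "l > 0" and "inj_on k {1..n}"
  shows "(\<Sum>i=1..n. 1 / PE n k l i) = 1"
proof -
  define x where "x i = exp (k i / l)" for i
  have inj: "inj_on x {1..n}"
  proof (rule inj_onI)
    fix i j assume "i \<in> {1..n}" "j \<in> {1..n}" "x i = x j"
    moreover from this have "k i = k j"
      using \<open>l > 0\<close> by (simp add: x_def)
    ultimately show "i = j"
      using inj_onD[OF \<open>inj_on k {1..n}\<close>] by blast
  qed
  have "1 / PE n k l i = (\<Prod>j\<in>{1..n} - {i}. (0 - x j) / (x i - x j))" if "i \<in> {1..n}" for i
  proof -
    have "1 / (1 - exp ((k i - k j) / l)) = (0 - x j) / (x i - x j)" if "j \<in> {1..n} - {i}" for j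
    proof -
      have "x i \<noteq> x j" using inj that \<open>i \<in> {1..n}\<close> by (auto dest: inj_onD)
      moreover have "exp ((k i - k j) / l) = x i / x j"
        by (simp add: x_def diff_divide_distrib exp_diff)
      moreover have "x j > 0" by (simp add: x_def)
      moreover have "1 / (1 - a / b) = (0 - b) / (a - b)" if "a \<noteq> b" "b > 0" for a b :: real
        using that by (simp add: divide_simps) (simp add: algebra_simps)
      ultimately show ?thesis by (simp only:)
    qed
    then have "(\<Prod>j\<in>{1..n} - {i}. 1 / (1 - exp ((k i - k j) / l)))
        = (\<Prod>j\<in>{1..n} - {i}. (0 - x j) / (x i - x j))"
      by (rule prod.cong[OF refl])
    then show ?thesis
      by (simp only: PE_def prod_dividef prod.neutral_const)
  qed
  then show ?thesis
    using sum_lagrange_basis_eq_1[OF _ _ inj, of 0] assms by simp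
qed

section \<open>Signed densities and distribution functions\<close>

text \<open>\<open>ennreal\<close> sends negative values to 0, so \<open>eq\<close> says that
  \<open>f\<close> and its positive part have the same integral. Their difference is the negative
  part of \<open>f\<close>, a nonnegative function with integral 0, which vanishes almost
  everywhere.\<close>

lemma AE_nonneg_if_nn_integral_eq_integral:
  fixes f :: "'a \<Rightarrow> real"
  assumes int: "integrable M f" and eq: "(\<integral>\<^sup>+x. ennreal (f x) \<partial>M) = ennreal (\<integral>x. f x \<partial>M)"
    and nonneg: "0 \<le> (\<integral>x. f x \<partial>M)"
  shows "AE x in M. 0 \<le> f x"
proof -
  have int': "integrable M (\<lambda>x. max 0 (f x))"
    using int by simp
  have "ennreal (\<integral>x. max 0 (f x) \<partial>M) = (\<integral>\<^sup>+x. ennreal (max 0 (f x)) \<partial>M)"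
    using int' by (intro nn_integral_eq_integral[symmetric]) auto
  also have "\<dots> = ennreal (\<integral>x. f x \<partial>M)"
    unfolding eq[symmetric] by (intro nn_integral_cong) (auto simp: max_def ennreal_neg)
  \<comment> \<open>\<open>ennreal\<close> is injective only on nonnegative reals, which is where
    \<open>nonneg\<close> enters.\<close>
  finally have "(\<integral>x. max 0 (f x) \<partial>M) = (\<integral>x. f x \<partial>M)"
    using nonneg by (subst (asm) ennreal_inj) auto
  then have "(\<integral>x. max 0 (f x) - f x \<partial>M) = 0"
    using int int' by simp
  then have "AE x in M. max 0 (f x) - f x = 0"
    using int int' by (subst (asm) integral_nonneg_eq_0_iff_AE) auto
  then show ?thesis by eventually_elim auto
qed

text \<open>The density gives the probability of \<open>{..t}\<close> as a nonnegative integral,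
  which equals the Lebesgue integral of \<open>f\<close> once \<open>f\<close> is nonnegative almost
  everywhere. The almost-everywhere form is what can be supplied for the mixed density.\<close>

lemma cdf_distributed:
  assumes X: "distributed M lborel X (\<lambda>s. ennreal (f s))"
    and int: "integrable lborel f" and nonneg: "AE s in lborel. 0 \<le> f s"
  shows "cdf (distr M borel X) t = (LINT s:{..t}|lborel. f s)"
proof -
  have X_meas: "X \<in> borel_measurable M"
    using distributed_measurable[OF X] by simp
  have "cdf (distr M borel X) t = measure M (X -` {..t} \<inter> space M)"
    using X_meas by (simp add: cdf_def measure_distr)
  also have "\<dots> = enn2real (\<integral>\<^sup>+s. ennreal (f s) * indicator {..t} s \<partial>lborel)"
    using distributed_emeasure[OF X, of "{..t}"] by (simp add: measure_def)
  also have "\<dots> = enn2real (\<integral>\<^sup>+s. ennreal (indicator {..t} s * f s) \<partial>lborel)"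
    by (intro arg_cong[of _ _ enn2real] nn_integral_cong) (auto simp: indicator_def)
  also have "\<dots> = (\<integral>s. indicator {..t} s * f s \<partial>lborel)"
    using int nonneg by (intro integral_eq_nn_integral[symmetric]) (auto elim: eventually_mono)
  finally show ?thesis by (simp add: set_lebesgue_integral_def)
qed

section \<open>The extreme value distribution\<close>

lemma extreme_value_density_nonneg: "l > 0 \<Longrightarrow> 0 \<le> extreme_value_density k l s"
  by (simp add: extreme_value_density_def)

text \<open>This antiderivative tends to 0 at \<open>-\<infinity>\<close> and to 1 at
  \<open>\<infinity>\<close>, so it is the distribution function itself.\<close>

lemma has_real_derivative_extreme_value:
  assumes "l > 0"
  shows "((\<lambda>s. exp (- exp ((k - s) / l))) has_real_derivative extreme_value_density k l s) (at s)"
  unfolding extreme_value_density_def exp_add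
  using assms by (auto intro!: derivative_eq_intros simp: field_simps)

lemma isCont_extreme_value_density: "isCont (extreme_value_density k l) s"
  unfolding extreme_value_density_def divide_inverse by (intro continuous_intros)

lemma extreme_value_tendsto_at_bot:
  fixes k l :: real
  assumes "l > 0"
  shows "((\<lambda>s. exp (- exp ((k - s) / l))) \<longlongrightarrow> 0) at_bot"
  using assms by real_asymp

lemma extreme_value_tendsto_at_top:
  fixes k l :: real
  assumes "l > 0"
  shows "((\<lambda>s. exp (- exp ((k - s) / l))) \<longlongrightarrow> 1) at_top"
  using assms by real_asymp

lemma
  assumes "l > 0"
  shows integrable_extreme_value_density: "integrable lborel (extreme_value_density k l)"
    and integral_extreme_value_density: "(\<integral>s. extreme_value_density k l s \<partial>lborel) = 1"
proof -
  \<comment> \<open>For a nonnegative derivative the fundamental theorem yields both integrability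
    and the value of the integral; 0 and 1 are the limits of the antiderivative at the two
    ends.\<close>
  note FTC = interval_integral_FTC_nonneg[of "-\<infinity>" "\<infinity>" "\<lambda>s. exp (- exp ((k - s) / l))"
      "extreme_value_density k l" 0 1]
  note lims = extreme_value_tendsto_at_bot[OF assms] extreme_value_tendsto_at_top[OF assms]
  have "set_integrable lborel (einterval (-\<infinity>) \<infinity>) (extreme_value_density k l)"
    by (rule FTC) (use lims assms in \<open>auto simp: ereal_tendsto_simps extreme_value_density_nonneg
      isCont_extreme_value_density intro!: has_real_derivative_extreme_value\<close>)
  then show "integrable lborel (extreme_value_density k l)"
    by (simp add: set_integrable_def)
  have "(LBINT s=-\<infinity>..\<infinity>. extreme_value_density k l s) = 1 - 0"
    by (rule FTC) (use lims assms in \<open>auto simp: ereal_tendsto_simps extreme_value_density_nonneg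
      isCont_extreme_value_density intro!: has_real_derivative_extreme_value\<close>)
  then show "(\<integral>s. extreme_value_density k l s \<partial>lborel) = 1"
    by (simp add: interval_lebesgue_integral_def set_lebesgue_integral_def)
qed

lemma set_integral_extreme_value_density:
  assumes "l > 0"
  shows "(LINT s:{..t}|lborel. extreme_value_density k l s) = exp (- exp ((k - t) / l))"
proof -
  define F where "F = (\<lambda>s::real. exp (- exp ((k - s) / l)))"
  have "(F \<longlongrightarrow> F t) (at_left t)"
    unfolding F_def using assms by (auto intro!: tendsto_eq_intros)
  then have "(LBINT s=-\<infinity>..ereal t. extreme_value_density k l s) = F t - 0"
    by (intro interval_integral_FTC_nonneg)
      (use extreme_value_tendsto_at_bot[OF assms] assms in
        \<open>auto simp: F_def ereal_tendsto_simps extreme_value_density_nonneg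
          isCont_extreme_value_density intro!: has_real_derivative_extreme_value\<close>)
  also have "(LBINT s=-\<infinity>..ereal t. extreme_value_density k l s)
      = (LINT s:{..<t}|lborel. extreme_value_density k l s)"
    by (simp add: interval_lebesgue_integral_def)
  \<comment> \<open>The interval integral omits the endpoint \<open>t\<close>, whereas
    \<open>cdf\<close> includes it; a single point is a null set.\<close>
  also have "\<dots> = (LINT s:{..t}|lborel. extreme_value_density k l s)"
    unfolding set_lebesgue_integral_def
  proof (rule integral_cong_AE)
    show "AE s in lborel. indicator {..<t} s *\<^sub>R extreme_value_density k l s
        = indicator {..t} s *\<^sub>R extreme_value_density k l s"
      using AE_lborel_singleton[of t] by eventually_elim (auto simp: indicator_def)
  qed (use integrable_extreme_value_density[OF assms] in auto)
  finally show ?thesis by (simp add: F_def)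
qed

section \<open>Integrals of the mixed density\<close>

lemma integrable_MHE_density:
  assumes "l > 0"
  shows "integrable lborel (MHE_density n k l)"
  unfolding MHE_density_def[abs_def] using assms
  by (intro Bochner_Integration.integrable_sum integrable_mult_right integrable_extreme_value_density)

text \<open>Every component integrates to 1, so the integral is the sum of the weights. This value
  is later compared with the total mass of \<open>M\<close>.\<close>

lemma integral_MHE_density:
  assumes "n \<ge> 1" and "l > 0" and "inj_on k {1..n}"
  shows "(\<integral>s. MHE_density n k l s \<partial>lborel) = 1"
proof -
  have "(\<integral>s. MHE_density n k l s \<partial>lborel)
      = (\<Sum>i=1..n. \<integral>s. 1 / PE n k l i * extreme_value_density (k i) l s \<partial>lborel)"
    unfolding MHE_density_def[abs_def] using \<open>l > 0\<close>
    by (intro Bochner_Integration.integral_sum integrable_mult_right integrable_extreme_value_density)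
  also have "\<dots> = (\<Sum>i=1..n. 1 / PE n k l i)"
    using \<open>l > 0\<close> by (simp only: integral_mult_right_zero integral_extreme_value_density mult_1_right)
  finally show ?thesis
    using sum_inverse_PE[OF assms] by simp
qed

lemma set_integral_MHE_density:
  assumes "l > 0"
  shows "(LINT s:{..t}|lborel. MHE_density n k l s)
    = (\<Sum>i=1..n. 1 / PE n k l i * exp (- exp ((k i - t) / l)))"
proof -
  have int: "set_integrable lborel {..t} (\<lambda>s. 1 / PE n k l i * extreme_value_density (k i) l s)" for i
    unfolding set_integrable_def
    by (intro integrable_mult_indicator integrable_mult_right integrable_extreme_value_density assms)
      simp
  have "(LINT s:{..t}|lborel. MHE_density n k l s)
      = (\<Sum>i=1..n. LINT s:{..t}|lborel. 1 / PE n k l i * extreme_value_density (k i) l s)"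
    unfolding set_lebesgue_integral_def MHE_density_def scaleR_sum_right
    by (intro Bochner_Integration.integral_sum int[unfolded set_integrable_def])
  then show ?thesis
    by (simp only: set_integral_mult_right set_integral_extreme_value_density[OF assms])
qed

theorem mainTheorem19:
  fixes n :: nat and l :: real and k :: "nat \<Rightarrow> real"
    and M :: "'a measure" and Z :: "'a \<Rightarrow> real"
    and N :: "nat \<Rightarrow> 'b measure" and Y :: "nat \<Rightarrow> 'b \<Rightarrow> real"
    and t :: real
  assumes "n \<ge> 2" and "l > 0"
    and "inj_on k {1..n}"
    and "prob_space M"
    and "distributed M lborel Z (\<lambda>s. ennreal (MHE_density n k l s))"
    and "\<And>i. i \<in> {1..n} \<Longrightarrow> prob_space (N i)"
    and "\<And>i. i \<in> {1..n} \<Longrightarrow>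
           distributed (N i) lborel (Y i) (\<lambda>s. ennreal (extreme_value_density (k i) l s))"
  shows "cdf (distr M borel Z) t
           = (\<Sum>i=1..n. 1 / PE n k l i * cdf (distr (N i) borel (Y i)) t) \<and>
         (\<Sum>i=1..n. 1 / PE n k l i * cdf (distr (N i) borel (Y i)) t)
           = (\<Sum>i=1..n. 1 / (\<Prod>j\<in>{1..n} - {i}. 1 - exp ((k i - k j) / l))
                         * exp (- exp (- ((t - k i) / l))))"
proof -
  \<comment> \<open>The weights have mixed signs, so nonnegativity is not visible from the formula;
    it is inferred from the existence of \<open>Z\<close>.\<close>
  have dens_Z: "AE s in lborel. 0 \<le> MHE_density n k l s"
  proof (rule AE_nonneg_if_nn_integral_eq_integral)
    have int1: "(\<integral>s. MHE_density n k l s \<partial>lborel) = 1"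
      using assms by (intro integral_MHE_density) auto
    then show "0 \<le> (\<integral>s. MHE_density n k l s \<partial>lborel)" by simp
    show "integrable lborel (MHE_density n k l)"
      using assms by (intro integrable_MHE_density)
    \<comment> \<open>Taking the event \<open>UNIV\<close> identifies the integral of the truncated
      density with the total mass of \<open>M\<close>, which is 1.\<close>
    have "(\<integral>\<^sup>+s. ennreal (MHE_density n k l s) \<partial>lborel) = emeasure M (space M)"
      using distributed_emeasure[OF assms(5), of UNIV] by simp
    then show "(\<integral>\<^sup>+s. ennreal (MHE_density n k l s) \<partial>lborel)
        = ennreal (\<integral>s. MHE_density n k l s \<partial>lborel)"
      using prob_space.emeasure_space_1[OF assms(4)] int1 by simp
  qed
  have Z: "cdf (distr M borel Z) t = (\<Sum>i=1..n. 1 / PE n k l i * exp (- exp ((k i - t) / l)))"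
    using cdf_distributed[OF assms(5) integrable_MHE_density[OF assms(2)] dens_Z]
      set_integral_MHE_density[OF assms(2)] by simp
  have "cdf (distr (N i) borel (Y i)) t = exp (- exp ((k i - t) / l))" if "i \<in> {1..n}" for i
    using cdf_distributed[OF assms(7)[OF that] integrable_extreme_value_density[OF assms(2)]]
      extreme_value_density_nonneg[OF assms(2)] set_integral_extreme_value_density[OF assms(2)]
    by simp
  then have Y: "(\<Sum>i=1..n. 1 / PE n k l i * cdf (distr (N i) borel (Y i)) t)
      = (\<Sum>i=1..n. 1 / PE n k l i * exp (- exp ((k i - t) / l)))"
    by (intro sum.cong) auto
  \<comment> \<open>This reconciles the exponent of the antiderivative with the sign convention of
    the stated formula.\<close>
  have "(k i - t) / l = - ((t - k i) / l)" for i
    by (simp add: add_divide_distrib diff_divide_distrib)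
  then show ?thesis
    unfolding Z Y by (simp only: PE_def)
qed

end
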